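(* Let $\alpha,\beta,\gamma>0$ and $\lambda\in\mathbb{R}$. The partial derivative $\frac{\partial}{\partial\beta}\left(t^{\beta-1}E_{\alpha,\beta}^{\gamma}(\lambda t^{\alpha})\right)$ is a convoluted form with kernel of logarithmic type: $$\frac{\partial}{\partial\beta}\left(t^{\beta-1}E_{\alpha,\beta}^{\gamma}(\lambda t^{\alpha})\right)=\int_0^t\left(\ln(t-t_1)+\gamma_0\right)t_1^{\beta-2}\,E_{\alpha,\beta-1}^{\gamma}(\lambda t_1^{\alpha})\,dt_1$$ for every $t\ge0$.
   Context: $E_{\alpha,\beta}^{\gamma}(z)=\sum_{k=0}^{\infty}\frac{(\gamma)_k\,z^k}{k!\,\Gamma(\alpha k+\beta)}$ is the Prabhakar function, where $(\gamma)_k=\gamma(\gamma+1)\cdots(\gamma+k-1)$, $(\gamma)_0=1$, and $1/\Gamma$ is taken to be $0$ at the poles of $\Gamma$. $\gamma_0$ is the Euler–Mascheroni constant (unrelated to the parameter $\gamma$).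
   Formalization: The formula is proved as printed only for β>1 (all t≥0). For β<1 the integral generally diverges, and for β=1 the formula fails (λ=0: left ln t+γ₀, right 0). For all β>0, t>0 it is proved with the right side read as the t-derivative of the convolution of ln+γ₀ with t^(β-1)E_{α,β}^γ(λt^α). *)

theory Defs
  imports "HOL-Analysis.Analysis"
begin

text \<open>
  The reciprocal Gamma function \<^const>\<open>rGamma\<close> is entire and vanishes at the poles of
  \<^const>\<open>Gamma\<close>, so coefficients with \<open>a * k + b\<close> a non-positive integer are \<open>0\<close>.
\<close>

definition prabhakar :: "real \<Rightarrow> real \<Rightarrow> real \<Rightarrow> real \<Rightarrow> real" where
  "prabhakar a b c z =
     (\<Sum>k. pochhammer c k * z ^ k / fact k * rGamma (a * real k + b))"

text \<open>
  Regularized convolution. If \<open>f\<close> is locally integrable on \<open>[0, \<infinity>)\<close>, its distributional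
  derivative \<open>Df\<close> (of \<open>f\<close> extended by \<open>0\<close> to the negative axis) may fail to be given by an
  integrable function: for \<open>f t = t powr (b - 1)\<close> with \<open>0 < b < 1\<close> the pointwise derivative is
  not integrable at \<open>0\<close>, and for \<open>b = 1\<close> one has \<open>Df = \<delta>\<close>, which the pointwise derivative
  does not see. The convolution \<open>K * Df\<close> is then understood as \<open>D(K * f)\<close>. The predicate below
  says that this convolution has the classical value \<open>v\<close> at \<open>t\<close>, where \<open>g\<close> is the pointwise
  derivative of \<open>f\<close> on \<open>(0, \<infinity>)\<close>; so \<open>v\<close> is the regularized meaning of the integral of
  \<open>K (t - s) * g s\<close> over \<open>0 < s < t\<close>. Both \<open>f\<close> and \<open>g\<close> are arguments because \<open>g\<close>
  determines \<open>f\<close>, hence \<open>Df\<close>, only up to an additive constant (up to a multiple of \<open>\<delta>\<close>).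
\<close>

definition has_regularized_convolution ::
    "(real \<Rightarrow> real) \<Rightarrow> (real \<Rightarrow> real) \<Rightarrow> (real \<Rightarrow> real) \<Rightarrow> real \<Rightarrow> real \<Rightarrow> bool" where
  "has_regularized_convolution K f g v t \<longleftrightarrow>
     (\<forall>x>0. f absolutely_integrable_on {0..x}) \<and>
     (\<forall>x>0. (f has_real_derivative g x) (at x)) \<and>
     (\<forall>x>0. (\<lambda>s. K (x - s) * f s) absolutely_integrable_on {0..x}) \<and>
     ((\<lambda>x. integral {0..x} (\<lambda>s. K (x - s) * f s)) has_real_derivative v) (at t)"

end

theory Submission
  imports Defs
begin

text \<open>
  Let \<open>h b x = x powr (b - 1) / Gamma b\<close> be the Riemann--Liouville kernel of order \<open>b\<close>. Since
  \<open>s powr (b - 1) * prabhakar \<alpha> b \<gamma> (lam * s powr \<alpha>)\<close> is the series of \<open>c k * h (\<alpha> * k + b) s\<close>, with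
  coefficients \<open>c k = pochhammer \<gamma> k * lam ^ k / fact k\<close> that do not depend on \<open>b\<close>, the claim
  reduces to one about \<open>h\<close>. Write \<open>h' b\<close> for the derivative of \<open>h b\<close> in the order \<open>b\<close>. For
  \<open>b > 0\<close>, differentiating the Beta integral in one of its arguments shows that the convolution of
  \<open>ln u + euler_mascheroni\<close> with \<open>h b\<close> is \<open>h' (b + 1)\<close> (lemma \<open>log_convolution_rl_kernel\<close>).
  Moreover, differentiation in \<open>x\<close> lowers the order by one both for \<open>h\<close> and for \<open>h'\<close>.

  If \<open>\<beta> > 1\<close>, taking \<open>b = \<beta> - 1 + \<alpha> * k\<close> and summing over \<open>k\<close> gives the formula with a convergent
  integral. If only \<open>\<beta> > 0\<close>, the same identity at \<open>b = \<beta> + \<alpha> * k\<close> computes the convolution with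
  the function itself, and its derivative in \<open>x\<close> is the regularized convolution.

  Working term by term is justified by the growth of the Gamma function: \<open>c k\<close> grows at most
  geometrically, while \<open>h (\<alpha> * k + b)\<close>, even when multiplied by \<open>Digamma\<close>, decays faster than any
  geometric sequence, locally uniformly in \<open>b\<close> and \<open>x\<close>
  (lemma \<open>rl_kernel_superexponential_decay\<close>). This yields termwise derivatives
  by the Weierstrass test, and the termwise convolution by dominated convergence
  (lemma \<open>weighted_integral_kernel_sum\<close>).
\<close>

section \<open>Bounds for the Gamma and Digamma functions\<close>

text \<open>
  Euler's integrand is at least \<open>A powr (y - 1) * exp (- (A + 1))\<close> on the interval from \<open>A\<close> to
  \<open>A + 1\<close>. As \<open>A\<close> is free, this shows that \<open>Gamma\<close> outgrows every exponential, which is all that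
  the convergence of the series requires.
\<close>

lemma Gamma_ge_powr_exp:
  fixes A y :: real
  assumes "A > 0" "y \<ge> 1"
  shows "A powr (y - 1) * exp (- (A + 1)) \<le> Gamma y"
proof -
  have "((\<lambda>t. A powr (y - 1) * exp (- (A + 1))) has_integral
          A powr (y - 1) * exp (- (A + 1))) {A..A+1}"
    using has_integral_const_real[of "A powr (y - 1) * exp (- (A + 1))" A "A + 1"] by simp
  moreover have "(\<lambda>t. t powr (y - 1) / exp t) integrable_on {A..A+1}"
    using assms by (intro integrable_continuous_real continuous_intros) auto
  then have "((\<lambda>t. t powr (y - 1) / exp t) has_integral
          integral {A..A+1} (\<lambda>t. t powr (y - 1) / exp t)) {A..A+1}"
    by (rule integrable_integral)
  moreover have "A powr (y - 1) * exp (- (A + 1)) \<le> t powr (y - 1) / exp t" if "t \<in> {A..A+1}" for t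
    unfolding divide_inverse exp_minus[symmetric]
    using that assms by (intro mult_mono powr_mono2) auto
  ultimately have "A powr (y - 1) * exp (- (A + 1)) \<le> integral {A..A+1} (\<lambda>t. t powr (y - 1) / exp t)"
    by (rule has_integral_le)
  also have "\<dots> \<le> Gamma y"
    by (rule has_integral_subset_le[OF _ \<open>(_ has_integral integral _ _) _\<close> Gamma_integral_real])
       (use assms in auto)
  finally show ?thesis .
qed

text \<open>
  \<open>ln y\<close> is the increment of \<open>ln_Gamma\<close> from \<open>y\<close> to \<open>y + 1\<close>, and its derivative \<open>Digamma\<close> is
  increasing.
\<close>

lemma Digamma_le_ln:
  fixes y :: real
  assumes "y > 0"
  shows "Digamma y \<le> ln y"
proof -
  have "\<exists>\<xi>. y < \<xi> \<and> \<xi> < y + 1 \<and> ln_Gamma (y + 1) - ln_Gamma y = (y + 1 - y) * Digamma \<xi>"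
    using assms by (intro MVT2) (auto intro!: derivative_eq_intros)
  then obtain \<xi> where \<xi>: "y < \<xi>" "ln_Gamma (y + 1) - ln_Gamma y = Digamma \<xi>"
    by auto
  have "Gamma (y + 1) = y * Gamma y"
    by (rule Gamma_plus1) (use assms nonpos_Ints_nonpos in force)
  moreover have "Gamma y \<noteq> 0"
    using Gamma_real_pos[OF assms] by linarith
  ultimately have "ln_Gamma (y + 1) - ln_Gamma y = ln y"
    using assms by (simp add: ln_Gamma_real_pos ln_mult)
  then show ?thesis
    using Digamma_real_mono[of y \<xi>] assms \<xi> by simp
qed

section \<open>Convolution of powers with the logarithm\<close>

lemma DERIV_imp_difference_quotient_LIMSEQ:
  fixes f :: "real \<Rightarrow> real"
  assumes "(f has_real_derivative D) (at a)"
  shows "(\<lambda>n. (f (a + inverse (Suc n)) - f a) * Suc n) \<longlonglongrightarrow> D"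
proof -
  have "((\<lambda>h. (f (a + h) - f a) / h) \<longlongrightarrow> D) (at 0)"
    using assms by (simp add: DERIV_def)
  moreover have "filterlim (\<lambda>n. inverse (real (Suc n))) (at 0) sequentially"
    unfolding filterlim_at using LIMSEQ_inverse_real_of_nat by auto
  ultimately have "(\<lambda>n. (f (a + inverse (Suc n)) - f a) / inverse (Suc n)) \<longlonglongrightarrow> D"
    by (rule filterlim_compose)
  then show ?thesis by (simp add: field_simps)
qed

text \<open>
  This is the derivative at \<open>p = 1\<close> of the Beta integral of \<open>u powr (a - 1) * (1 - u) powr (p - 1)\<close>.
  The difference quotients in \<open>p\<close> with the steps \<open>1 / (n + 1)\<close> are dominated by a multiple of the
  integrand of \<open>Beta a (1/2)\<close>.
\<close>

lemma has_integral_powr_ln_one_minus: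
  fixes a :: real
  assumes "a > 0"
  shows "((\<lambda>u. u powr (a - 1) * ln (1 - u)) has_integral
            - (Digamma (a + 1) + euler_mascheroni) / a) {0..1}"
proof -
  define \<epsilon> where "\<epsilon> n = inverse (real (Suc n))" for n
  have \<epsilon>_pos: "\<epsilon> n > 0" for n by (simp add: \<epsilon>_def)
  define f where "f n u = u powr (a - 1) * (((1 - u) powr \<epsilon> n - 1) * Suc n)" for n u
  have powr_int: "((\<lambda>u. u powr (a - 1) * (1 - u) powr \<delta>) has_integral Beta a (1 + \<delta>)) {0<..<1}"
    if "\<delta> > -1" for \<delta>
    using has_integral_Beta_real[of a "1 + \<delta>"] that assms by (simp add: has_integral_Icc_iff_Ioo)
  have "a \<notin> \<int>\<^sub>\<le>\<^sub>0" using assms nonpos_Ints_nonpos by force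
  then have Beta_1: "Beta a 1 = 1 / a"
    using Gamma_plus1[of a] by (simp add: Beta_def Gamma_eq_zero_iff)
  have f_int: "(f n has_integral (Beta a (1 + \<epsilon> n) - Beta a 1) * Suc n) {0<..<1}" for n
  proof -
    have int: "((\<lambda>u. (u powr (a - 1) * (1 - u) powr \<epsilon> n - u powr (a - 1) * (1 - u) powr 0) * Suc n)
            has_integral (Beta a (1 + \<epsilon> n) - Beta a (1 + 0)) * Suc n) {0<..<1}"
      using \<epsilon>_pos[of n]
      by (intro has_integral_mult_left has_integral_diff powr_int) auto
    have eq: "(u powr (a - 1) * (1 - u) powr \<epsilon> n - u powr (a - 1) * (1 - u) powr 0) * Suc n = f n u"
      if "u \<in> {0<..<1}" for u
      using that by (simp add: f_def algebra_simps)
    from has_integral_eq[OF eq int] show ?thesis by simp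
  qed
  have h_int: "(\<lambda>u. 2 * (u powr (a - 1) * (1 - u) powr (-1/2))) integrable_on {0<..<1}"
    using powr_int[of "-1/2"] by (intro integrable_on_mult_right) auto
  have f_le: "norm (f n u) \<le> 2 * (u powr (a - 1) * (1 - u) powr (-1/2))" if "u \<in> {0<..<1}" for n u
  proof -
    define y where "y = 1 - u"
    have y: "0 < y" "y < 1" using that by (auto simp: y_def)
    \<comment> \<open>The difference quotient lies between \<open>ln y\<close> and \<open>0\<close>, and the singularity of \<open>ln y\<close> at \<open>0\<close>
      is weaker than that of \<open>y powr (-1/2)\<close>.\<close>
    have "1 + \<epsilon> n * ln y \<le> exp (\<epsilon> n * ln y)" by (rule exp_ge_add_one_self)
    also have "\<dots> = y powr \<epsilon> n" using y by (simp add: powr_def)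
    finally have "1 - y powr \<epsilon> n \<le> \<epsilon> n * (- ln y)" by simp
    then have "(1 - y powr \<epsilon> n) * Suc n \<le> \<epsilon> n * (- ln y) * Suc n"
      by (rule mult_right_mono) simp
    also have "\<dots> = - ln y" by (simp add: \<epsilon>_def field_simps)
    also have "- ln y = 2 * ln (y powr (-1/2))" using y by (simp add: ln_powr)
    also have "\<dots> \<le> 2 * y powr (-1/2)"
      using ln_le_minus_one[of "y powr (-1/2)"] y by simp
    finally have "(1 - y powr \<epsilon> n) * Suc n \<le> 2 * y powr (-1/2)" .
    moreover have "y powr \<epsilon> n \<le> 1" using y \<epsilon>_pos[of n] by (simp add: powr_le1)
    then have "\<bar>(y powr \<epsilon> n - 1) * Suc n\<bar> = (1 - y powr \<epsilon> n) * Suc n"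
      by (simp add: abs_mult)
    ultimately have "\<bar>(y powr \<epsilon> n - 1) * Suc n\<bar> \<le> 2 * y powr (-1/2)"
      by simp
    then have "u powr (a - 1) * \<bar>(y powr \<epsilon> n - 1) * Suc n\<bar> \<le> u powr (a - 1) * (2 * y powr (-1/2))"
      by (rule mult_left_mono) simp
    then show ?thesis by (simp add: f_def y_def abs_mult mult_ac)
  qed
  have f_lim: "(\<lambda>n. f n u) \<longlonglongrightarrow> u powr (a - 1) * ln (1 - u)" if "u \<in> {0<..<1}" for u
  proof -
    have "((\<lambda>p. (1 - u) powr p) has_real_derivative ln (1 - u)) (at 0)"
      using that by (auto intro!: derivative_eq_intros)
    from DERIV_imp_difference_quotient_LIMSEQ[OF this]
    show ?thesis unfolding f_def \<epsilon>_def
      using that by (intro tendsto_mult_left) auto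
  qed
  have "((\<lambda>p. Beta a p) has_real_derivative Beta a 1 * (Digamma 1 - Digamma (a + 1))) (at 1)"
    by (rule has_field_derivative_Beta2) (use assms nonpos_Ints_nonpos in force)+
  from DERIV_imp_difference_quotient_LIMSEQ[OF this]
  have "(\<lambda>n. (Beta a (1 + \<epsilon> n) - Beta a 1) * Suc n) \<longlonglongrightarrow> - (Digamma (a + 1) + euler_mascheroni) / a"
    unfolding \<epsilon>_def using Beta_1 by (simp add: field_simps)
  with f_lim
  have "((\<lambda>u. u powr (a - 1) * ln (1 - u)) has_integral
            - (Digamma (a + 1) + euler_mascheroni) / a) {0<..<1}"
    by (intro has_integral_dominated_convergence[OF f_int h_int] ballI f_le) auto
  then show ?thesis by (simp add: has_integral_Icc_iff_Ioo)
qed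

text \<open>
  Substituting \<open>s = x * u\<close> splits \<open>ln (x - s)\<close> into \<open>ln x + ln (1 - u)\<close>. The constant
  \<open>euler_mascheroni\<close> in the kernel cancels the one produced by \<open>Digamma 1\<close> in the Beta integral.
\<close>

lemma log_convolution_powr:
  fixes b x :: real
  assumes "b > 0" "x > 0"
  shows "((\<lambda>s. (ln (x - s) + euler_mascheroni) * s powr (b - 1)) has_integral
            x powr b / b * (ln x - Digamma (b + 1))) {0..x}" (is ?int)
    and "(\<lambda>s. (ln (x - s) + euler_mascheroni) * s powr (b - 1)) absolutely_integrable_on {0..x}"
      (is ?abs)
proof -
  define f where "f u = u powr (b - 1) * ln (1 - u)" for u :: real
  define I where "I = - (Digamma (b + 1) + euler_mascheroni) / b"
  define G where "G s = x powr (b - 1) * f (s / x) + (ln x + euler_mascheroni) * s powr (b - 1)" for s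
  have "(f has_integral I) (cbox 0 1)"
    using has_integral_powr_ln_one_minus[OF assms(1)] by (simp add: f_def[abs_def] I_def)
  from has_integral_affinity'[OF this, of "1 / x" 0]
  have f_int: "((\<lambda>s. f (s / x)) has_integral I * x) {0..x}"
    using assms by (simp add: field_simps)
  have p_int: "((\<lambda>s. s powr (b - 1)) has_integral x powr b / b) {0..x}"
    using has_integral_powr_from_0[of "b - 1" x] assms by simp
  have "(G has_integral x powr (b - 1) * (I * x) + (ln x + euler_mascheroni) * (x powr b / b)) {0..x}"
    unfolding G_def by (intro has_integral_add has_integral_mult_right f_int p_int)
  moreover have "x powr (b - 1) * (I * x) + (ln x + euler_mascheroni) * (x powr b / b)
      = x powr b / b * (ln x - Digamma (b + 1))"
    using assms powr_mult_base[of x "b - 1"] by (simp add: I_def field_simps)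
  ultimately have G_int: "(G has_integral x powr b / b * (ln x - Digamma (b + 1))) {0..x}"
    by simp
  \<comment> \<open>At \<open>s = x\<close> the two sides may differ because of the convention \<open>ln 0 = 0\<close>.\<close>
  have G_eq: "(ln (x - s) + euler_mascheroni) * s powr (b - 1) = G s" if "s \<in> {0..x} - {0, x}" for s
  proof -
    have s: "0 < s" "s < x" using that by auto
    have "x - s = x * (1 - s / x)" using s by (simp add: field_simps)
    also have "ln \<dots> = ln x + ln (1 - s / x)" using s by (intro ln_mult_pos) (auto simp: field_simps)
    finally show ?thesis using s by (simp add: G_def f_def powr_divide field_simps)
  qed
  have "norm (G s) \<le> x powr (b - 1) * - f (s / x) + \<bar>ln x + euler_mascheroni\<bar> * s powr (b - 1)"
    if "s \<in> {0..x}" for s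
  proof -
    have "f (s / x) \<le> 0"
    proof (cases "s = x")
      case False
      then have "ln (1 - s / x) \<le> 0"
        using that assms by (subst ln_le_zero_iff) (auto simp: field_simps)
      then show ?thesis
        unfolding f_def by (intro mult_nonneg_nonpos) auto
    qed (simp add: f_def assms)
    then have "\<bar>x powr (b - 1) * f (s / x)\<bar> = x powr (b - 1) * - f (s / x)"
      by (simp add: abs_mult)
    moreover have "\<bar>(ln x + euler_mascheroni) * s powr (b - 1)\<bar>
        = \<bar>ln x + euler_mascheroni\<bar> * s powr (b - 1)"
      by (simp add: abs_mult)
    ultimately show ?thesis
      using abs_triangle_ineq[of "x powr (b - 1) * f (s / x)" "(ln x + euler_mascheroni) * s powr (b - 1)"]
      unfolding G_def real_norm_def by linarith
  qed
  moreover have "(\<lambda>s. x powr (b - 1) * - f (s / x) + \<bar>ln x + euler_mascheroni\<bar> * s powr (b - 1))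
      integrable_on {0..x}"
    using f_int p_int by (intro integrable_add integrable_on_mult_right integrable_neg) auto
  ultimately have "G absolutely_integrable_on {0..x}"
    using G_int by (intro absolutely_integrable_integrable_bound) auto
  then show ?abs
    by (rule absolutely_integrable_spike[where S="{0,x}"]) (use G_eq in auto)
  show ?int
    by (rule has_integral_spike_finite[where S="{0,x}", OF _ G_eq G_int]) simp
qed

section \<open>The Riemann--Liouville kernel and its derivatives\<close>

text \<open>
  The Riemann--Liouville kernel, whose convolution with a function is the fractional integral of
  order \<open>b\<close>.
\<close>

definition rl_kernel :: "real \<Rightarrow> real \<Rightarrow> real" where
  "rl_kernel b x = x powr (b - 1) * rGamma b"

text \<open>
  The derivative of the Riemann--Liouville kernel in its order \<open>b\<close>. The formula is meant for
  \<open>b > 0\<close>, where \<open>rGamma\<close> has the logarithmic derivative \<open>- Digamma b\<close>.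
\<close>

definition rl_kernel_deriv :: "real \<Rightarrow> real \<Rightarrow> real" where
  "rl_kernel_deriv b x = rl_kernel b x * (ln x - Digamma b)"

text \<open>
  The theorem for a single kernel, in integrated form: convolution with \<open>ln u + euler_mascheroni\<close>
  differentiates in the order and raises the order by one.
\<close>

lemma log_convolution_rl_kernel:
  assumes "b > 0" "x > 0"
  shows "((\<lambda>s. (ln (x - s) + euler_mascheroni) * rl_kernel b s) has_integral
           rl_kernel_deriv (b + 1) x) {0..x}"
proof -
  have "rGamma b = b * rGamma (b + 1)" by (rule rGamma_plus1[symmetric])
  then have eq: "rGamma b * (x powr b / b * (ln x - Digamma (b + 1))) = rl_kernel_deriv (b + 1) x"
    using assms by (simp add: rl_kernel_deriv_def rl_kernel_def)
  from has_integral_mult_right[OF log_convolution_powr(1)[OF assms], of "rGamma b"]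
  show ?thesis unfolding eq by (simp add: rl_kernel_def mult_ac)
qed

lemma DERIV_rl_kernel_index:
  assumes "b > 0" "x > 0"
  shows "((\<lambda>b. rl_kernel b x) has_real_derivative rl_kernel_deriv b x) (at b)"
proof -
  have "b \<notin> \<int>\<^sub>\<le>\<^sub>0" using assms nonpos_Ints_nonpos by force
  then show ?thesis unfolding rl_kernel_def rl_kernel_deriv_def
    using assms by (auto intro!: derivative_eq_intros simp: algebra_simps)
qed

lemma DERIV_rl_kernel:
  assumes "x > 0"
  shows "(rl_kernel b has_real_derivative rl_kernel (b - 1) x) (at x)"
proof -
  have "rGamma (b - 1) = (b - 1) * rGamma b" using rGamma_plus1[of "b - 1"] by simp
  moreover have "(rl_kernel b has_real_derivative (b - 1) * x powr (b - 1 - 1) * rGamma b) (at x)"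
    unfolding rl_kernel_def[abs_def]
    by (intro DERIV_cmult_right has_real_derivative_powr assms)
  ultimately show ?thesis by (simp add: rl_kernel_def mult_ac)
qed

text \<open>
  Differentiation in \<open>x\<close> commutes with differentiation in the order, so it lowers the order here
  as it does for the kernel itself. In the computation, the term that comes from the derivative
  of \<open>ln x\<close> accounts for the difference \<open>1 / b\<close> of \<open>Digamma\<close> at \<open>b + 1\<close> and \<open>b\<close>.
\<close>

lemma DERIV_rl_kernel_deriv:
  assumes "b > 0" "x > 0"
  shows "(rl_kernel_deriv (b + 1) has_real_derivative rl_kernel_deriv b x) (at x)"
proof -
  have D: "(rl_kernel (b + 1) has_real_derivative rl_kernel b x) (at x)"
    using DERIV_rl_kernel[OF assms(2), of "b + 1"] by simp
  have "Digamma (b + 1) = Digamma b + 1 / b" using assms by (intro Digamma_plus1) auto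
  moreover have "rl_kernel (b + 1) x * (1 / x) = rl_kernel b x / b"
    using assms rGamma_plus1[of b, symmetric] by (simp add: rl_kernel_def powr_diff)
  moreover have "(rl_kernel_deriv (b + 1) has_real_derivative
      rl_kernel b x * (ln x - Digamma (b + 1)) + rl_kernel (b + 1) x * (1 / x)) (at x)"
    unfolding rl_kernel_deriv_def using assms
    by (auto intro!: derivative_eq_intros D)
  ultimately show ?thesis
    by (simp add: rl_kernel_deriv_def algebra_simps)
qed

section \<open>Series of Riemann--Liouville kernels\<close>

text \<open>
  One bound serves every termwise operation below: it is geometric with an arbitrarily small
  ratio \<open>r\<close>, uniform in \<open>x\<close> down to \<open>0\<close> and in all orders from \<open>\<alpha> * k + b0\<close> and \<open>3\<close> upwards.
  A factor \<open>Digamma b\<close> costs nothing, since it is at most \<open>b - 1\<close> and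
  \<open>(b - 1) * rGamma b = rGamma (b - 1)\<close>.
\<close>

lemma rl_kernel_superexponential_decay:
  fixes \<alpha> b0 X r :: real
  assumes "\<alpha> > 0" "X > 0" "r > 0"
  obtains C where "\<And>k b x. b \<ge> \<alpha> * real k + b0 \<Longrightarrow> b \<ge> 3 \<Longrightarrow> 0 < x \<Longrightarrow> x \<le> X \<Longrightarrow>
      \<bar>rl_kernel b x\<bar> \<le> C * r ^ k \<and> \<bar>rl_kernel b x * Digamma b\<bar> \<le> C * r ^ k"
proof -
  \<comment> \<open>Bounding \<open>Gamma\<close> with the base \<open>A = X * R\<close> cancels \<open>X\<close> and leaves \<open>R powr (1 - b)\<close>, whose
    ratio \<open>R powr (- \<alpha>)\<close> in \<open>k\<close> is at most \<open>r\<close>. Having \<open>R \<ge> 1\<close> makes it decrease in \<open>b\<close>.\<close>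
  define R where "R = max 1 (r powr (- 1 / \<alpha>))"
  define A where "A = X * R"
  have R: "R \<ge> 1" by (simp add: R_def)
  have A: "A > 0" using R assms by (simp add: A_def)
  have "R powr (- \<alpha>) \<le> (r powr (- 1 / \<alpha>)) powr (- \<alpha>)"
    using assms by (intro powr_mono2') (auto simp: R_def)
  also have "\<dots> = r" using assms by (simp add: powr_powr)
  finally have R_r: "R powr (- \<alpha>) \<le> r" .
  have bound: "\<bar>rl_kernel b x\<bar> \<le> exp (A + 1) * A * R powr (1 - b0) * r ^ k \<and>
        \<bar>rl_kernel b x * Digamma b\<bar> \<le> exp (A + 1) * A * R powr (1 - b0) * r ^ k"
    if b: "b \<ge> \<alpha> * real k + b0" "b \<ge> 3" and x: "0 < x" "x \<le> X" for k b x
  proof -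
    have rG: "rGamma (b - 1) = (b - 1) * rGamma b" using rGamma_plus1[of "b - 1"] by simp
    have rG_pos: "rGamma b > 0" using b by (simp add: rGamma_inverse_Gamma)
    have "0 < Digamma b" using b by (intro Digamma_real_ge_three_halves_pos) auto
    have "Digamma b \<le> ln b" using b by (intro Digamma_le_ln) auto
    also have "\<dots> \<le> b - 1" using b by (intro ln_le_minus_one) auto
    finally have "Digamma b \<le> b - 1" .
    have weight: "x powr (b - 1) * rGamma b * c \<le> x powr (b - 1) * rGamma (b - 1)" if "c \<le> b - 1" for c
    proof -
      have "x powr (b - 1) * rGamma b * c \<le> x powr (b - 1) * rGamma b * (b - 1)"
        using rG_pos that by (intro mult_left_mono) auto
      then show ?thesis by (simp add: rG mult_ac)
    qed
    have "rGamma (b - 1) \<le> inverse (A powr (b - 1 - 1) * exp (- (A + 1)))"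
      unfolding rGamma_inverse_Gamma using b A
      by (intro le_imp_inverse_le Gamma_ge_powr_exp) auto
    also have "\<dots> = exp (A + 1) * A powr (1 - (b - 1))"
      using A by (simp add: powr_minus[symmetric] exp_minus[symmetric] algebra_simps)
    finally have "x powr (b - 1) * rGamma (b - 1) \<le> X powr (b - 1) * (exp (A + 1) * A powr (1 - (b - 1)))"
      using b x rG rG_pos by (intro mult_mono powr_mono2) auto
    also have "A powr (1 - (b - 1)) = A * (X powr (1 - b) * R powr (1 - b))"
      using A assms R powr_mult_base[of A "1 - b"] by (simp add: A_def powr_mult)
    also have "X powr (b - 1) * (exp (A + 1) * (A * (X powr (1 - b) * R powr (1 - b))))
        = exp (A + 1) * A * R powr (1 - b)"
      using powr_add[of X "b - 1" "1 - b"] assms by (simp add: mult_ac)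
    also have "\<dots> \<le> exp (A + 1) * A * (R powr (1 - b0) * r ^ k)"
    proof (intro mult_left_mono)
      have "R powr (1 - b) \<le> R powr ((1 - b0) + (- \<alpha>) * real k)"
        using R b by (intro powr_mono) auto
      also have "\<dots> = R powr (1 - b0) * (R powr (- \<alpha>)) ^ k"
        using R by (subst powr_add) (simp add: powr_realpow[symmetric] powr_powr)
      also have "\<dots> \<le> R powr (1 - b0) * r ^ k"
        using R_r by (intro mult_left_mono power_mono) auto
      finally show "R powr (1 - b) \<le> R powr (1 - b0) * r ^ k" .
    qed (use A in auto)
    finally have "x powr (b - 1) * rGamma (b - 1) \<le> exp (A + 1) * A * R powr (1 - b0) * r ^ k"
      by (simp add: mult_ac)
    with weight[of 1] weight[of "Digamma b"] \<open>0 < Digamma b\<close> \<open>Digamma b \<le> b - 1\<close> rG_pos b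
    show ?thesis by (auto simp: rl_kernel_def abs_mult)
  qed
  show thesis by (rule that[OF bound])
qed

lemma summable_geometric_eventually:
  fixes f :: "nat \<Rightarrow> real"
  assumes "\<forall>\<^sub>F k in sequentially. \<bar>f k\<bar> \<le> C * (1/2) ^ k"
  shows "summable (\<lambda>k. \<bar>f k\<bar>)"
  by (rule summable_comparison_test_ev[where g = "\<lambda>k. C * (1/2) ^ k"])
     (use assms in \<open>auto intro!: summable_mult\<close>)

lemma has_field_derivative_series_geometric:
  fixes f f' :: "nat \<Rightarrow> real \<Rightarrow> real"
  assumes "open S" "convex S" "x \<in> S"
    and "\<And>n y. y \<in> S \<Longrightarrow> (f n has_real_derivative f' n y) (at y)"
    and "summable (\<lambda>n. f n x)"
    and "\<forall>\<^sub>F n in sequentially. \<forall>y\<in>S. \<bar>f' n y\<bar> \<le> C * (1/2) ^ n"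
  shows "((\<lambda>y. \<Sum>n. f n y) has_real_derivative (\<Sum>n. f' n x)) (at x)"
proof (rule has_field_derivative_series'(2)[of S f f' x x])
  show "uniformly_convergent_on S (\<lambda>n y. \<Sum>i<n. f' i y)"
    using assms by (intro Weierstrass_m_test'_ev[where M = "\<lambda>n. C * (1/2) ^ n"] summable_mult) auto
qed (use assms in \<open>auto simp: interior_open intro: has_field_derivative_at_within\<close>)

text \<open>
  Of the Prabhakar coefficients, only their geometric growth matters; the decay of the kernels
  beats every such growth.
\<close>

locale rl_kernel_series =
  fixes c :: "nat \<Rightarrow> real" and Q \<alpha> :: real
  assumes c_le: "\<And>k. \<bar>c k\<bar> \<le> Q ^ k" and Q_pos: "Q > 0" and \<alpha>_pos: "\<alpha> > 0"
begin

definition kernel_sum :: "real \<Rightarrow> real \<Rightarrow> real" where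
  "kernel_sum b x = (\<Sum>k. c k * rl_kernel (\<alpha> * real k + b) x)"

definition kernel_deriv_sum :: "real \<Rightarrow> real \<Rightarrow> real" where
  "kernel_deriv_sum b x = (\<Sum>k. c k * rl_kernel_deriv (\<alpha> * real k + b) x)"

lemma geometric_bound_kernel_Digamma:
  assumes "X > 0"
  obtains C where "\<forall>\<^sub>F k in sequentially. \<forall>b\<ge>b0. \<forall>x\<in>{0<..X}.
      \<bar>c k * rl_kernel (\<alpha> * real k + b) x\<bar> \<le> C * (1/2) ^ k \<and>
      \<bar>c k * rl_kernel (\<alpha> * real k + b) x * Digamma (\<alpha> * real k + b)\<bar> \<le> C * (1/2) ^ k"
proof -
  \<comment> \<open>The ratio \<open>1 / (2 * Q)\<close> absorbs the growth \<open>Q ^ k\<close> of the coefficients and leaves \<open>(1/2) ^ k\<close>.\<close>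
  obtain C where C: "\<And>k b x. b \<ge> \<alpha> * real k + b0 \<Longrightarrow> b \<ge> 3 \<Longrightarrow> 0 < x \<Longrightarrow> x \<le> X \<Longrightarrow>
      \<bar>rl_kernel b x\<bar> \<le> C * (1 / (2 * Q)) ^ k \<and> \<bar>rl_kernel b x * Digamma b\<bar> \<le> C * (1 / (2 * Q)) ^ k"
    using rl_kernel_superexponential_decay[OF \<alpha>_pos assms, of "1 / (2 * Q)" b0] Q_pos by auto
  have "filterlim (\<lambda>k. \<alpha> * real k + b0) at_top sequentially"
    using \<alpha>_pos by real_asymp
  then have large: "\<forall>\<^sub>F k in sequentially. \<alpha> * real k + b0 \<ge> 3"
    by (simp add: filterlim_at_top)
  have coeff: "\<bar>c k * v\<bar> \<le> C * (1/2) ^ k" if "\<bar>v\<bar> \<le> C * (1 / (2 * Q)) ^ k" for k v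
  proof -
    have "\<bar>c k * v\<bar> \<le> Q ^ k * (C * (1 / (2 * Q)) ^ k)"
      unfolding abs_mult using that c_le Q_pos by (intro mult_mono) auto
    also have "\<dots> = C * (Q * (1 / (2 * Q))) ^ k"
      by (simp only: power_mult_distrib mult_ac)
    finally show ?thesis using Q_pos by simp
  qed
  from large have "\<forall>\<^sub>F k in sequentially. \<forall>b\<ge>b0. \<forall>x\<in>{0<..X}.
      \<bar>c k * rl_kernel (\<alpha> * real k + b) x\<bar> \<le> C * (1/2) ^ k \<and>
      \<bar>c k * rl_kernel (\<alpha> * real k + b) x * Digamma (\<alpha> * real k + b)\<bar> \<le> C * (1/2) ^ k"
  proof (rule eventually_mono, intro allI impI ballI conjI, goal_cases)
    case (1 k b x)
    then show ?case using C[of k "\<alpha> * real k + b" x] by (intro coeff) auto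
  next
    case (2 k b x)
    then show ?case unfolding mult.assoc[of "c k"]
      using C[of k "\<alpha> * real k + b" x] by (intro coeff) auto
  qed
  then show thesis by (rule that)
qed

text \<open>
  Unlike for the kernels themselves, \<open>x\<close> has to stay away from \<open>0\<close> because of the factor \<open>ln x\<close>.
\<close>

lemma geometric_bound_kernel_deriv:
  assumes "0 < x0" "x0 \<le> X"
  obtains C where "\<forall>\<^sub>F k in sequentially. \<forall>b\<ge>b0. \<forall>x\<in>{x0..X}.
      \<bar>c k * rl_kernel_deriv (\<alpha> * real k + b) x\<bar> \<le> C * (1/2) ^ k"
proof -
  define L where "L = max \<bar>ln x0\<bar> \<bar>ln X\<bar>"
  obtain C where C: "\<forall>\<^sub>F k in sequentially. \<forall>b\<ge>b0. \<forall>x\<in>{0<..X}.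
      \<bar>c k * rl_kernel (\<alpha> * real k + b) x\<bar> \<le> C * (1/2) ^ k \<and>
      \<bar>c k * rl_kernel (\<alpha> * real k + b) x * Digamma (\<alpha> * real k + b)\<bar> \<le> C * (1/2) ^ k"
    by (rule geometric_bound_kernel_Digamma[of X b0]) (use assms in linarith)
  have "\<forall>\<^sub>F k in sequentially. \<forall>b\<ge>b0. \<forall>x\<in>{x0..X}.
      \<bar>c k * rl_kernel_deriv (\<alpha> * real k + b) x\<bar> \<le> ((L + 1) * C) * (1/2) ^ k"
    using C
  proof (rule eventually_mono, intro allI impI ballI)
    fix k b x
    let ?h = "c k * rl_kernel (\<alpha> * real k + b) x" and ?p = "Digamma (\<alpha> * real k + b)"
    assume H: "\<forall>b\<ge>b0. \<forall>x\<in>{0<..X}.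
      \<bar>c k * rl_kernel (\<alpha> * real k + b) x\<bar> \<le> C * (1/2) ^ k \<and>
      \<bar>c k * rl_kernel (\<alpha> * real k + b) x * Digamma (\<alpha> * real k + b)\<bar> \<le> C * (1/2) ^ k"
      and b: "b \<ge> b0" and x: "x \<in> {x0..X}"
    have h: "\<bar>?h\<bar> \<le> C * (1/2) ^ k" "\<bar>?h * ?p\<bar> \<le> C * (1/2) ^ k"
      using H b x assms by auto
    have "ln x0 \<le> ln x" "ln x \<le> ln X" using x assms by auto
    then have "\<bar>ln x\<bar> \<le> L" unfolding L_def by linarith
    then have "\<bar>?h * ln x\<bar> \<le> (C * (1/2) ^ k) * L"
      unfolding abs_mult[of ?h] using h(1) by (intro mult_mono) auto
    moreover have "c k * rl_kernel_deriv (\<alpha> * real k + b) x = ?h * ln x - ?h * ?p"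
      by (simp add: rl_kernel_deriv_def algebra_simps)
    ultimately show "\<bar>c k * rl_kernel_deriv (\<alpha> * real k + b) x\<bar> \<le> ((L + 1) * C) * (1/2) ^ k"
      using h(2) by (simp add: algebra_simps)
  qed
  then show thesis by (rule that)
qed

lemma summable_abs_kernel:
  assumes "x > 0"
  shows "summable (\<lambda>k. \<bar>c k * rl_kernel (\<alpha> * real k + b) x\<bar>)"
proof -
  obtain C where "\<forall>\<^sub>F k in sequentially. \<forall>b'\<ge>b. \<forall>y\<in>{0<..x}.
      \<bar>c k * rl_kernel (\<alpha> * real k + b') y\<bar> \<le> C * (1/2) ^ k \<and>
      \<bar>c k * rl_kernel (\<alpha> * real k + b') y * Digamma (\<alpha> * real k + b')\<bar> \<le> C * (1/2) ^ k"
    by (rule geometric_bound_kernel_Digamma[OF assms])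
  then have "\<forall>\<^sub>F k in sequentially. \<bar>c k * rl_kernel (\<alpha> * real k + b) x\<bar> \<le> C * (1/2) ^ k"
    by eventually_elim (use assms in auto)
  then show ?thesis by (rule summable_geometric_eventually)
qed

lemma DERIV_kernel_sum:
  assumes "x > 0"
  shows "(kernel_sum b has_real_derivative kernel_sum (b - 1) x) (at x)"
proof -
  have "2 * x > 0" using assms by simp
  then obtain C where "\<forall>\<^sub>F k in sequentially. \<forall>b'\<ge>b - 1. \<forall>y\<in>{0<..2 * x}.
      \<bar>c k * rl_kernel (\<alpha> * real k + b') y\<bar> \<le> C * (1/2) ^ k \<and>
      \<bar>c k * rl_kernel (\<alpha> * real k + b') y * Digamma (\<alpha> * real k + b')\<bar> \<le> C * (1/2) ^ k"
    by (rule geometric_bound_kernel_Digamma)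
  then have "\<forall>\<^sub>F k in sequentially. \<forall>y\<in>{0<..<2 * x}.
      \<bar>c k * rl_kernel (\<alpha> * real k + (b - 1)) y\<bar> \<le> C * (1/2) ^ k"
    by eventually_elim auto
  then show ?thesis
    unfolding kernel_sum_def[abs_def]
  proof (rule has_field_derivative_series_geometric[rotated -1])
    fix k y assume "y \<in> {0<..<2 * x}"
    then show "((\<lambda>x. c k * rl_kernel (\<alpha> * real k + b) x) has_real_derivative
                 c k * rl_kernel (\<alpha> * real k + (b - 1)) y) (at y)"
      using DERIV_rl_kernel[of y "\<alpha> * real k + b"]
      by (intro DERIV_cmult) (simp add: algebra_simps)
  next
    show "summable (\<lambda>k. c k * rl_kernel (\<alpha> * real k + b) x)"
      using summable_abs_kernel[OF assms] by (rule summable_rabs_cancel)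
  qed (use assms in auto)
qed

lemma DERIV_kernel_sum_index:
  assumes "b > 0" "x > 0"
  shows "((\<lambda>b. kernel_sum b x) has_real_derivative kernel_deriv_sum b x) (at b)"
proof -
  obtain C where "\<forall>\<^sub>F k in sequentially. \<forall>b'\<ge>0. \<forall>y\<in>{x..x}.
      \<bar>c k * rl_kernel_deriv (\<alpha> * real k + b') y\<bar> \<le> C * (1/2) ^ k"
    by (rule geometric_bound_kernel_deriv[OF assms(2) order_refl])
  then have "\<forall>\<^sub>F k in sequentially. \<forall>b'\<in>{0<..}.
      \<bar>c k * rl_kernel_deriv (\<alpha> * real k + b') x\<bar> \<le> C * (1/2) ^ k"
    by eventually_elim auto
  then show ?thesis
    unfolding kernel_sum_def kernel_deriv_sum_def
  proof (rule has_field_derivative_series_geometric[rotated -1])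
    fix k :: nat and b' :: real assume "b' \<in> {0<..}"
    then have "\<alpha> * real k + b' > 0" using \<alpha>_pos by (intro add_nonneg_pos) auto
    from DERIV_rl_kernel_index[OF this assms(2)]
    have "((\<lambda>b. rl_kernel (\<alpha> * real k + b) x) has_real_derivative
             rl_kernel_deriv (\<alpha> * real k + b') x) (at b')"
      by (simp add: DERIV_shift add.commute)
    then show "((\<lambda>b. c k * rl_kernel (\<alpha> * real k + b) x) has_real_derivative
                 c k * rl_kernel_deriv (\<alpha> * real k + b') x) (at b')"
      by (rule DERIV_cmult)
  next
    show "summable (\<lambda>k. c k * rl_kernel (\<alpha> * real k + b) x)"
      using summable_abs_kernel[OF assms(2)] by (rule summable_rabs_cancel)
  qed (use assms in auto)
qed

lemma DERIV_kernel_deriv_sum: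
  assumes "b > 0" "x > 0"
  shows "(kernel_deriv_sum (b + 1) has_real_derivative kernel_deriv_sum b x) (at x)"
proof -
  obtain C where C: "\<forall>\<^sub>F k in sequentially. \<forall>b'\<ge>b. \<forall>y\<in>{x / 2..2 * x}.
      \<bar>c k * rl_kernel_deriv (\<alpha> * real k + b') y\<bar> \<le> C * (1/2) ^ k"
    by (rule geometric_bound_kernel_deriv[of "x / 2" "2 * x" b]) (use assms in auto)
  then have "\<forall>\<^sub>F k in sequentially. \<forall>y\<in>{x / 2<..<2 * x}.
      \<bar>c k * rl_kernel_deriv (\<alpha> * real k + b) y\<bar> \<le> C * (1/2) ^ k"
    by eventually_elim auto
  then show ?thesis
    unfolding kernel_deriv_sum_def[abs_def]
  proof (rule has_field_derivative_series_geometric[rotated -1])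
    fix k :: nat and y :: real assume y: "y \<in> {x / 2<..<2 * x}"
    have "\<alpha> * real k + b > 0" using \<alpha>_pos assms by (intro add_nonneg_pos) auto
    with y show "((\<lambda>x. c k * rl_kernel_deriv (\<alpha> * real k + (b + 1)) x) has_real_derivative
                 c k * rl_kernel_deriv (\<alpha> * real k + b) y) (at y)"
      using DERIV_rl_kernel_deriv[of "\<alpha> * real k + b" y] assms
      by (intro DERIV_cmult) (simp add: add.assoc)
  next
    have "\<forall>\<^sub>F k in sequentially. \<bar>c k * rl_kernel_deriv (\<alpha> * real k + (b + 1)) x\<bar> \<le> C * (1/2) ^ k"
      using C by eventually_elim (use assms in auto)
    then show "summable (\<lambda>k. c k * rl_kernel_deriv (\<alpha> * real k + (b + 1)) x)"
      by (rule summable_rabs_cancel[OF summable_geometric_eventually])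
  qed (use assms in auto)
qed

text \<open>
  Integration term by term against a weight \<open>w\<close> of any sign. On the interval up to \<open>x\<close>, replacing
  \<open>s powr (\<alpha> * k)\<close> by \<open>x powr (\<alpha> * k)\<close> bounds every partial sum by a constant times
  \<open>s powr (b - 1)\<close>; so absolute integrability of the weight against that single power is enough to
  dominate.
\<close>

lemma weighted_integral_kernel_sum:
  fixes w :: "real \<Rightarrow> real"
  assumes "b > 0" "x > 0"
    and w: "(\<lambda>s. w s * s powr (b - 1)) absolutely_integrable_on {0..x}"
    and I: "\<And>k. ((\<lambda>s. w s * rl_kernel (\<alpha> * real k + b) s) has_integral I k) {0..x}"
  shows "(\<lambda>s. w s * kernel_sum b s) absolutely_integrable_on {0..x}" (is ?abs)
    and "(\<lambda>k. c k * I k) sums integral {0..x} (\<lambda>s. w s * kernel_sum b s)" (is ?sums)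
proof -
  define a where "a k = \<bar>c k\<bar> * x powr (\<alpha> * real k) * rGamma (\<alpha> * real k + b)" for k
  have idx: "\<alpha> * real k + b > 0" for k using \<alpha>_pos assms by (intro add_nonneg_pos) auto
  have rG: "rGamma (\<alpha> * real k + b) > 0" for k
    using Gamma_real_pos[OF idx[of k]] by (simp add: rGamma_inverse_Gamma)
  have "\<bar>c k * rl_kernel (\<alpha> * real k + b) x\<bar> = x powr (b - 1) * a k" for k
    using rG[of k] assms powr_add[of x "\<alpha> * real k" "b - 1"]
    by (simp add: a_def rl_kernel_def abs_mult add_diff_eq mult_ac)
  with summable_abs_kernel[OF assms(2), of b] have a_summable: "summable a"
    using assms(2) by (simp add: summable_mult_D)
  have a_nonneg: "a k \<ge> 0" for k using rG[of k] by (simp add: a_def)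
  have term_le: "\<bar>c k * rl_kernel (\<alpha> * real k + b) s\<bar> \<le> a k * s powr (b - 1)"
    if "s \<in> {0..x}" for k s
  proof -
    have "s powr (\<alpha> * real k + b - 1) = s powr (\<alpha> * real k) * s powr (b - 1)"
      using powr_add[of s "\<alpha> * real k" "b - 1"] by (simp add: add_diff_eq)
    then have "\<bar>c k * rl_kernel (\<alpha> * real k + b) s\<bar>
        = \<bar>c k\<bar> * s powr (\<alpha> * real k) * rGamma (\<alpha> * real k + b) * s powr (b - 1)"
      using rG[of k] by (simp add: rl_kernel_def abs_mult mult_ac)
    also have "\<dots> \<le> a k * s powr (b - 1)"
      unfolding a_def using rG[of k] that \<alpha>_pos
      by (intro mult_right_mono mult_left_mono powr_mono2) auto
    finally show ?thesis .
  qed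
  define f where "f n s = w s * (\<Sum>k<n. c k * rl_kernel (\<alpha> * real k + b) s)" for n s
  define h where "h s = suminf a * \<bar>w s * s powr (b - 1)\<bar>" for s
  have f_int: "(f n has_integral (\<Sum>k<n. c k * I k)) {0..x}" for n
  proof -
    have "((\<lambda>s. \<Sum>k<n. c k * (w s * rl_kernel (\<alpha> * real k + b) s)) has_integral (\<Sum>k<n. c k * I k)) {0..x}"
      by (intro has_integral_sum has_integral_mult_right I) auto
    then show ?thesis by (simp add: f_def[abs_def] sum_distrib_left mult_ac)
  qed
  have h_int: "h integrable_on {0..x}"
    unfolding h_def using w by (intro integrable_on_mult_right) (simp add: absolutely_integrable_on_def)
  have f_le: "norm (f n s) \<le> h s" if "s \<in> {0..x}" for n s
  proof -
    have "\<bar>\<Sum>k<n. c k * rl_kernel (\<alpha> * real k + b) s\<bar> \<le> (\<Sum>k<n. a k * s powr (b - 1))"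
      using term_le[OF that] by (intro order_trans[OF sum_abs] sum_mono)
    also have "\<dots> \<le> suminf a * s powr (b - 1)"
      unfolding sum_distrib_right[symmetric]
      using a_summable a_nonneg by (intro mult_right_mono sum_le_suminf) auto
    finally have "\<bar>w s\<bar> * \<bar>\<Sum>k<n. c k * rl_kernel (\<alpha> * real k + b) s\<bar> \<le> \<bar>w s\<bar> * (suminf a * s powr (b - 1))"
      by (rule mult_left_mono) simp
    then show ?thesis by (simp add: f_def h_def abs_mult mult_ac)
  qed
  have f_lim: "(\<lambda>n. f n s) \<longlonglongrightarrow> w s * kernel_sum b s" if "s \<in> {0..x}" for s
  proof -
    have "summable (\<lambda>k. \<bar>c k * rl_kernel (\<alpha> * real k + b) s\<bar>)"
      by (rule summable_comparison_test'[where N=0, OF summable_mult2[OF a_summable, of "s powr (b - 1)"]])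
         (use term_le[OF that] in auto)
    then have "(\<lambda>k. c k * rl_kernel (\<alpha> * real k + b) s) sums kernel_sum b s"
      unfolding kernel_sum_def by (rule summable_sums[OF summable_rabs_cancel])
    then show ?thesis unfolding f_def sums_def by (rule tendsto_mult_left)
  qed
  have f_on: "f n integrable_on {0..x}" for n using f_int by blast
  note lim = dominated_convergence[OF f_on h_int f_le f_lim]
  have "norm (w s * kernel_sum b s) \<le> h s" if "s \<in> {0..x}" for s
    using f_le[OF that] tendsto_norm[OF f_lim[OF that]] by (intro LIMSEQ_le_const2) auto
  with lim(1) h_int show ?abs
    by (intro absolutely_integrable_integrable_bound[where g = h]) auto
  have "(\<lambda>n. integral {0..x} (f n)) = (\<lambda>n. \<Sum>k<n. c k * I k)"
    using f_int by (auto simp: integral_unique)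
  with lim(2) show ?sums by (simp add: sums_def)
qed

lemma absolutely_integrable_kernel_sum:
  assumes "b > 0" "x > 0"
  shows "kernel_sum b absolutely_integrable_on {0..x}"
proof -
  have p_int: "((\<lambda>s. s powr (b' - 1)) has_integral x powr b' / b') {0..x}" if "b' > 0" for b'
    using has_integral_powr_from_0[of "b' - 1" x] assms that by simp
  have "(\<lambda>s. 1 * s powr (b - 1)) absolutely_integrable_on {0..x}"
    using p_int[OF assms(1)] by (intro nonnegative_absolutely_integrable_1) auto
  moreover have "((\<lambda>s. 1 * rl_kernel (\<alpha> * real k + b) s) has_integral
      x powr (\<alpha> * real k + b) / (\<alpha> * real k + b) * rGamma (\<alpha> * real k + b)) {0..x}" for k
    unfolding rl_kernel_def mult_1 using \<alpha>_pos assms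
    by (intro has_integral_mult_left p_int add_nonneg_pos) auto
  ultimately have "(\<lambda>s. 1 * kernel_sum b s) absolutely_integrable_on {0..x}"
    by (rule weighted_integral_kernel_sum(1)[OF assms])
  then show ?thesis by simp
qed

text \<open>
  The theorem in integrated form: the logarithmic convolution of the series of order \<open>b\<close> is the
  order derivative at \<open>b + 1\<close>.
\<close>

lemma log_convolution_kernel_sum:
  assumes "b > 0" "x > 0"
  shows "(\<lambda>s. (ln (x - s) + euler_mascheroni) * kernel_sum b s) absolutely_integrable_on {0..x}"
    and "integral {0..x} (\<lambda>s. (ln (x - s) + euler_mascheroni) * kernel_sum b s)
           = kernel_deriv_sum (b + 1) x"
proof -
  have "((\<lambda>s. (ln (x - s) + euler_mascheroni) * rl_kernel (\<alpha> * real k + b) s) has_integral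
          rl_kernel_deriv (\<alpha> * real k + (b + 1)) x) {0..x}" for k
    using log_convolution_rl_kernel[of "\<alpha> * real k + b" x] \<alpha>_pos assms
    by (simp add: add_nonneg_pos add.assoc)
  note * = weighted_integral_kernel_sum[OF assms log_convolution_powr(2)[OF assms] this]
  show "(\<lambda>s. (ln (x - s) + euler_mascheroni) * kernel_sum b s) absolutely_integrable_on {0..x}"
    by (rule *(1))
  show "integral {0..x} (\<lambda>s. (ln (x - s) + euler_mascheroni) * kernel_sum b s)
           = kernel_deriv_sum (b + 1) x"
    unfolding kernel_deriv_sum_def using *(2) by (rule sums_unique)
qed

end

section \<open>The Prabhakar function\<close>

lemma pochhammer_le_power_fact:
  fixes g :: real
  assumes "g \<ge> 0"
  shows "pochhammer g k \<le> (g + 1) ^ k * fact k"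
proof (induction k)
  case (Suc k)
  have "g + real k \<le> (g + 1) * (1 + real k)" using assms by (simp add: algebra_simps)
  with Suc assms have "pochhammer g k * (g + real k) \<le> ((g + 1) ^ k * fact k) * ((g + 1) * (1 + real k))"
    by (intro mult_mono) auto
  then show ?case by (simp add: pochhammer_Suc mult_ac)
qed simp

lemma rl_kernel_series_prabhakar:
  assumes "\<alpha> > 0" "g > 0"
  shows "rl_kernel_series (\<lambda>k. pochhammer g k * lam ^ k / fact k) ((g + 1) * (\<bar>lam\<bar> + 1)) \<alpha>"
proof
  fix k :: nat
  have "pochhammer g k / fact k \<le> (g + 1) ^ k"
    using pochhammer_le_power_fact[of g k] assms by (simp add: divide_le_eq)
  moreover have "\<bar>lam\<bar> ^ k \<le> (\<bar>lam\<bar> + 1) ^ k" by (intro power_mono) auto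
  ultimately have "pochhammer g k / fact k * \<bar>lam\<bar> ^ k \<le> (g + 1) ^ k * (\<bar>lam\<bar> + 1) ^ k"
    using assms by (intro mult_mono) auto
  then show "\<bar>pochhammer g k * lam ^ k / fact k\<bar> \<le> ((g + 1) * (\<bar>lam\<bar> + 1)) ^ k"
    using pochhammer_nonneg[of g k] assms
    by (simp add: abs_mult power_abs power_mult_distrib)
qed (use assms in auto)

text \<open>
  The identity includes \<open>s = 0\<close>, where both sides vanish because \<open>0 powr a = 0\<close> for every \<open>a\<close>.
\<close>

lemma kernel_sum_eq_prabhakar:
  assumes "\<alpha> > 0" "g > 0" "s \<ge> 0"
  shows "rl_kernel_series.kernel_sum (\<lambda>k. pochhammer g k * lam ^ k / fact k) \<alpha> b s
           = s powr (b - 1) * prabhakar \<alpha> b g (lam * s powr \<alpha>)"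
proof (cases "s = 0")
  case False
  interpret rl_kernel_series "\<lambda>k. pochhammer g k * lam ^ k / fact k" "(g + 1) * (\<bar>lam\<bar> + 1)" \<alpha>
    using assms by (intro rl_kernel_series_prabhakar)
  have s: "s > 0" using False assms by simp
  have eq: "pochhammer g k * lam ^ k / fact k * rl_kernel (\<alpha> * real k + b) s
      = s powr (b - 1) * (pochhammer g k * (lam * s powr \<alpha>) ^ k / fact k * rGamma (\<alpha> * real k + b))" for k
    using powr_add[of s "\<alpha> * real k" "b - 1"] s
    by (simp add: rl_kernel_def add_diff_eq power_mult_distrib powr_powr[symmetric] powr_realpow)
  have "summable (\<lambda>k. pochhammer g k * lam ^ k / fact k * rl_kernel (\<alpha> * real k + b) s)"
    using summable_abs_kernel[OF s] by (rule summable_rabs_cancel)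
  then have "summable (\<lambda>k. pochhammer g k * (lam * s powr \<alpha>) ^ k / fact k * rGamma (\<alpha> * real k + b))"
    unfolding eq using s by (simp add: summable_mult_D)
  then show ?thesis
    unfolding kernel_sum_def eq prabhakar_def by (rule suminf_mult)
next
  case True
  interpret rl_kernel_series "\<lambda>k. pochhammer g k * lam ^ k / fact k" "(g + 1) * (\<bar>lam\<bar> + 1)" \<alpha>
    using assms by (intro rl_kernel_series_prabhakar)
  from True show ?thesis by (simp add: kernel_sum_def rl_kernel_def)
qed

theorem theorem17:
  fixes \<alpha> \<beta> \<gamma> lam t :: real
  assumes "\<alpha> > 0" and "\<beta> > 0" and "\<gamma> > 0" and "t \<ge> 0"
  shows
    "(\<beta> > 1 \<longrightarrow>
        (\<lambda>s. (ln (t - s) + euler_mascheroni) * s powr (\<beta> - 2)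
              * prabhakar \<alpha> (\<beta> - 1) \<gamma> (lam * s powr \<alpha>)) absolutely_integrable_on {0..t} \<and>
        ((\<lambda>b. t powr (b - 1) * prabhakar \<alpha> b \<gamma> (lam * t powr \<alpha>)) has_real_derivative
           integral {0..t} (\<lambda>s. (ln (t - s) + euler_mascheroni) * s powr (\<beta> - 2)
              * prabhakar \<alpha> (\<beta> - 1) \<gamma> (lam * s powr \<alpha>))) (at \<beta>)) \<and>
     (t > 0 \<longrightarrow>
        (\<exists>D. ((\<lambda>b. t powr (b - 1) * prabhakar \<alpha> b \<gamma> (lam * t powr \<alpha>))
                 has_real_derivative D) (at \<beta>) \<and>
             has_regularized_convolution (\<lambda>u. ln u + euler_mascheroni)
               (\<lambda>s. s powr (\<beta> - 1) * prabhakar \<alpha> \<beta> \<gamma> (lam * s powr \<alpha>))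
               (\<lambda>s. s powr (\<beta> - 2) * prabhakar \<alpha> (\<beta> - 1) \<gamma> (lam * s powr \<alpha>))
               D t))"
proof -
  interpret rl_kernel_series "\<lambda>k. pochhammer \<gamma> k * lam ^ k / fact k" "(\<gamma> + 1) * (\<bar>lam\<bar> + 1)" \<alpha>
    using assms by (intro rl_kernel_series_prabhakar)
  define K :: "real \<Rightarrow> real" where "K u = ln u + euler_mascheroni" for u
  define f where "f b s = s powr (b - 1) * prabhakar \<alpha> b \<gamma> (lam * s powr \<alpha>)" for b s
  have f_eq: "f b s = kernel_sum b s" if "s \<ge> 0" for b s
    unfolding f_def using assms that by (intro kernel_sum_eq_prabhakar[symmetric])
  have g_eq: "s powr (\<beta> - 2) * prabhakar \<alpha> (\<beta> - 1) \<gamma> (lam * s powr \<alpha>) = f (\<beta> - 1) s" for s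
    by (simp add: f_def)
  have conv_abs: "(\<lambda>s. K (x - s) * f b s) absolutely_integrable_on {0..x}"
    and conv: "integral {0..x} (\<lambda>s. K (x - s) * f b s) = kernel_deriv_sum (b + 1) x"
    if "b > 0" "x > 0" for b x
  proof -
    show "(\<lambda>s. K (x - s) * f b s) absolutely_integrable_on {0..x}"
      by (rule absolutely_integrable_spike[OF log_convolution_kernel_sum(1)[OF that], of "{}"])
         (auto simp: f_eq K_def)
    show "integral {0..x} (\<lambda>s. K (x - s) * f b s) = kernel_deriv_sum (b + 1) x"
      unfolding log_convolution_kernel_sum(2)[OF that, symmetric]
      by (rule integral_cong) (auto simp: f_eq K_def)
  qed
  have D: "((\<lambda>b. f b t) has_real_derivative kernel_deriv_sum \<beta> t) (at \<beta>)" if "t > 0"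
    using DERIV_kernel_sum_index[OF assms(2) that] that by (simp add: f_eq)
  \<comment> \<open>For \<open>\<beta> > 1\<close> the order \<open>\<beta> - 1\<close> is still positive, so the convolution can be taken there directly.\<close>
  have classical: "(\<lambda>s. K (t - s) * f (\<beta> - 1) s) absolutely_integrable_on {0..t} \<and>
        ((\<lambda>b. f b t) has_real_derivative integral {0..t} (\<lambda>s. K (t - s) * f (\<beta> - 1) s)) (at \<beta>)"
    if "\<beta> > 1"
  proof (cases "t = 0")
    case True
    then show ?thesis by (auto simp: f_def intro: absolutely_integrable_negligible)
  next
    case False
    with assms that conv_abs[of "\<beta> - 1" t] conv[of "\<beta> - 1" t] D show ?thesis by simp
  qed
  \<comment> \<open>Convolving at order \<open>\<beta>\<close> gives the order derivative at \<open>\<beta> + 1\<close>; differentiating it in \<open>x\<close>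
    returns to \<open>\<beta>\<close>, also when \<open>\<beta> - 1 \<le> 0\<close>.\<close>
  have regularized: "has_regularized_convolution K (f \<beta>) (f (\<beta> - 1)) (kernel_deriv_sum \<beta> t) t"
    if "t > 0"
    unfolding has_regularized_convolution_def
  proof (intro conjI allI impI)
    fix x :: real assume x: "x > 0"
    show "f \<beta> absolutely_integrable_on {0..x}"
      by (rule absolutely_integrable_spike[OF absolutely_integrable_kernel_sum[OF assms(2) x], of "{}"])
         (auto simp: f_eq)
    show "(f \<beta> has_real_derivative f (\<beta> - 1) x) (at x)"
      unfolding f_eq[OF less_imp_le[OF x]]
      by (rule has_field_derivative_transform_within_open[OF DERIV_kernel_sum[OF x], of "{0<..}"])
         (use x in \<open>auto simp: f_eq\<close>)
    show "(\<lambda>s. K (x - s) * f \<beta> s) absolutely_integrable_on {0..x}"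
      using assms x by (intro conv_abs)
  next
    show "((\<lambda>x. integral {0..x} (\<lambda>s. K (x - s) * f \<beta> s)) has_real_derivative
             kernel_deriv_sum \<beta> t) (at t)"
      by (rule has_field_derivative_transform_within_open
            [OF DERIV_kernel_deriv_sum[OF assms(2) that], of "{0<..}"])
         (use assms that in \<open>auto simp: conv\<close>)
  qed
  show ?thesis
    unfolding mult.assoc g_eq
    using classical D regularized unfolding f_def K_def by blast
qed

end
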